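(* Let $m$ be a positive integer, let $a_1,\dots,a_m$ be real numbers, and let $P_m:C[0,1]\to C[0,1]$ be the polynomial type operator $P_m(f)=a_mf^m+a_{m-1}f^{m-1}+\dots+a_1f$. Then: (i) $P_m$ is Fréchet differentiable on $C[0,1]$, and for every $\bar f\in C[0,1]$ the Fréchet derivative $\nabla P_m(\bar f):C[0,1]\to C[0,1]$ satisfies $$\nabla P_m(\bar f)(g)=\sum_{i=1}^m i a_i\bar f^{\,i-1}g\quad\text{for every } g\in C[0,1].$$ (ii) $P_m$ is Gâteaux differentiable on $C[0,1]$, and for every $\bar f\in C[0,1]$ the Gâteaux derivative satisfies $$(P_m)'(\bar f)(g)=\nabla P_m(\bar f)(g)=\sum_{i=1}^m i a_i\bar f^{\,i-1}g\quad\text{for every } g\in C[0,1].$$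
   Context: $C[0,1]$ is the Banach space of real continuous functions on $[0,1]$ with norm $\|f\|_C=\max\{|f(x)|:x\in[0,1]\}$ and origin $\theta_C$; powers are pointwise and $f^0\equiv1$. A map $T:C[0,1]\to C[0,1]$ is Fréchet differentiable at $\bar f$ with derivative $\nabla T(\bar f)$ if $\nabla T(\bar f)$ is a continuous linear operator and $\lim_{u\to\theta_C}\frac{T(\bar f+u)-T(\bar f)-\nabla T(\bar f)(u)}{\|u\|_C}=\theta_C$. $T$ is Gâteaux differentiable at $\bar f$ if for every $g\neq\theta_C$ the norm limit $T'(\bar f)(g)=\lim_{t\to0}\frac{T(\bar f+tg)-T(\bar f)}{t}$ ($t$ real) exists; for $g=\theta_C$ the same limit is trivially $\theta_C$ and the same notation is used. *)

theory Defs
  imports "HOL-Analysis.Analysis"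
begin

section \<open>The space of continuous real functions on the unit interval\<close>

typedef unit_interval = "{0..1::real}"
  morphisms real_of_ui ui_of_real
  by (rule exI[of _ 0]) simp

instantiation unit_interval :: metric_space
begin

definition dist_unit_interval :: "unit_interval \<Rightarrow> unit_interval \<Rightarrow> real" where
  "dist_unit_interval x y = dist (real_of_ui x) (real_of_ui y)"

definition uniformity_unit_interval :: "(unit_interval \<times> unit_interval) filter" where
  "uniformity_unit_interval = (INF e\<in>{0<..}. principal {(x, y). dist x y < e})"

definition open_unit_interval :: "unit_interval set \<Rightarrow> bool" where
  "open_unit_interval S = (\<forall>x\<in>S. \<forall>\<^sub>F (x', y) in uniformity. x' = x \<longrightarrow> y \<in> S)"

instance
proof
  fix x y z :: unit_interval
  show "dist x y = 0 \<longleftrightarrow> x = y"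
    by (simp add: dist_unit_interval_def real_of_ui_inject)
  show "dist x y \<le> dist x z + dist y z"
    unfolding dist_unit_interval_def by (rule dist_triangle2)
qed (rule open_unit_interval_def uniformity_unit_interval_def)+

end

text \<open>Boundedness is automatic because \<^typ>\<open>unit_interval\<close> is compact, so the bounded continuous
  functions on it are all the continuous ones, and the supremum norm of
  \<^typ>\<open>unit_interval \<Rightarrow>\<^sub>C real\<close> is a maximum; see \<open>C01_of_continuous_on\<close>, \<open>continuous_on_C01\<close> and
  \<open>norm_C01\<close> below.\<close>

type_synonym C01 = "unit_interval \<Rightarrow>\<^sub>C real"

lemma continuous_on_real_of_ui: "continuous_on S real_of_ui"
  unfolding continuous_on_iff by (auto simp: dist_unit_interval_def)

lemma continuous_on_ui_of_real: "continuous_on {0..1} ui_of_real"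
  unfolding continuous_on_iff
  by (auto simp: dist_unit_interval_def ui_of_real_inverse)

lemma UNIV_unit_interval: "(UNIV :: unit_interval set) = ui_of_real ` {0..1}"
  using type_definition.Abs_image[OF type_definition_unit_interval] by simp

lemma compact_UNIV_unit_interval: "compact (UNIV :: unit_interval set)"
  unfolding UNIV_unit_interval
  by (rule compact_continuous_image[OF continuous_on_ui_of_real]) simp

lemma C01_of_continuous_on:
  fixes h :: "real \<Rightarrow> real"
  assumes "continuous_on {0..1} h"
  shows "\<exists>!f :: C01. \<forall>x. apply_bcontfun f x = h (real_of_ui x)"
proof -
  have c: "continuous_on UNIV (\<lambda>x. h (real_of_ui x))"
    by (rule continuous_on_compose2[OF assms continuous_on_real_of_ui])
      (use real_of_ui in auto)
  have "bounded (range (\<lambda>x. h (real_of_ui x)))"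
    by (rule compact_imp_bounded[OF compact_continuous_image[OF c compact_UNIV_unit_interval]])
  with c have "(\<lambda>x. h (real_of_ui x)) \<in> bcontfun"
    by (simp add: bcontfun_def)
  then obtain f :: C01 where f: "(\<lambda>x. h (real_of_ui x)) = apply_bcontfun f"
    by (rule bcontfunE)
  show ?thesis
  proof (rule ex1I[of _ f])
    show "\<forall>x. apply_bcontfun f x = h (real_of_ui x)"
      by (metis f)
    show "g = f" if "\<forall>x. apply_bcontfun g x = h (real_of_ui x)" for g :: C01
      using that f by (intro bcontfun_eqI) metis
  qed
qed

lemma continuous_on_C01:
  fixes f :: C01
  shows "continuous_on {0..1} (\<lambda>x. apply_bcontfun f (ui_of_real x))"
  by (rule continuous_on_compose2[OF continuous_on_apply_bcontfun[of UNIV] continuous_on_ui_of_real])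
    simp

lemma norm_C01:
  fixes f :: C01
  shows "\<exists>x. norm f = \<bar>apply_bcontfun f x\<bar> \<and> (\<forall>y. \<bar>apply_bcontfun f y\<bar> \<le> \<bar>apply_bcontfun f x\<bar>)"
proof -
  have "continuous_on UNIV (\<lambda>x. \<bar>apply_bcontfun f x\<bar>)"
    by (intro continuous_intros continuous_on_apply_bcontfun)
  then obtain x where x: "\<forall>y. \<bar>apply_bcontfun f y\<bar> \<le> \<bar>apply_bcontfun f x\<bar>"
    using continuous_attains_sup[OF compact_UNIV_unit_interval] by auto
  have "norm f = \<bar>apply_bcontfun f x\<bar>"
    using norm_bound[of f "\<bar>apply_bcontfun f x\<bar>"] norm_bounded[of f x] x by auto
  with x show ?thesis by blast
qed


section \<open>Pointwise multiplication of bounded continuous functions\<close>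

lemma times_cont:
  fixes f g :: "'a::topological_space \<Rightarrow> 'b::real_normed_algebra"
  assumes "f \<in> bcontfun" "g \<in> bcontfun"
  shows "(\<lambda>x. f x * g x) \<in> bcontfun"
proof -
  obtain F G :: "'a \<Rightarrow>\<^sub>C 'b" where [simp]: "f = apply_bcontfun F" "g = apply_bcontfun G"
    using assms by (metis bcontfunE)
  have "norm (F x * G x) \<le> norm F * norm G" for x
    by (rule order_trans[OF norm_mult_ineq]) (intro mult_mono norm_bounded norm_ge_zero)
  then show ?thesis
    by (intro bcontfun_normI[where b = "norm F * norm G"])
      (auto intro!: continuous_intros continuous_on_apply_bcontfun)
qed

instantiation bcontfun :: (topological_space, real_normed_algebra) real_normed_algebra
begin

definition times_bcontfun :: "('a \<Rightarrow>\<^sub>C 'b) \<Rightarrow> ('a \<Rightarrow>\<^sub>C 'b) \<Rightarrow> 'a \<Rightarrow>\<^sub>C 'b" where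
  "times_bcontfun f g = Bcontfun (\<lambda>x. apply_bcontfun f x * apply_bcontfun g x)"

lemma apply_bcontfun_times [simp]:
  "apply_bcontfun (f * g) x = apply_bcontfun f x * (apply_bcontfun g x :: 'b)"
  unfolding times_bcontfun_def
  by (subst Bcontfun_inverse) (simp_all add: times_cont apply_bcontfun)

instance
proof
  fix f g :: "'a \<Rightarrow>\<^sub>C 'b"
  show "norm (f * g) \<le> norm f * norm g"
  proof (rule norm_bound)
    show "norm (apply_bcontfun (f * g) x) \<le> norm f * norm g" for x
      unfolding apply_bcontfun_times
      by (rule order_trans[OF norm_mult_ineq]) (intro mult_mono norm_bounded norm_ge_zero)
  qed
qed (auto intro!: bcontfun_eqI simp: algebra_simps)

end

instantiation bcontfun :: (topological_space, real_normed_algebra_1) real_normed_algebra_1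
begin

definition one_bcontfun :: "'a \<Rightarrow>\<^sub>C 'b" where
  "one_bcontfun = const_bcontfun 1"

lemma apply_bcontfun_one [simp]: "apply_bcontfun (1 :: 'a \<Rightarrow>\<^sub>C 'b) x = 1"
  by (simp add: one_bcontfun_def)

instance
proof
  have "norm (1 :: 'a \<Rightarrow>\<^sub>C 'b) \<le> 1"
    by (rule norm_bound) simp
  moreover have "1 \<le> norm (1 :: 'a \<Rightarrow>\<^sub>C 'b)"
    using norm_bounded[of "1 :: 'a \<Rightarrow>\<^sub>C 'b"] by simp
  ultimately show norm_one: "norm (1 :: 'a \<Rightarrow>\<^sub>C 'b) = 1"
    by simp
  show "(0 :: 'a \<Rightarrow>\<^sub>C 'b) \<noteq> 1"
    by (metis apply_bcontfun_one zero_bcontfun.rep_eq zero_neq_one)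
qed (auto intro!: bcontfun_eqI)

end

instance bcontfun :: (topological_space, real_normed_field) comm_ring_1
  by standard (auto intro!: bcontfun_eqI simp: algebra_simps)

lemma apply_bcontfun_power [simp]:
  fixes f :: "'a::topological_space \<Rightarrow>\<^sub>C 'b::real_normed_algebra_1"
  shows "apply_bcontfun (f ^ n) x = apply_bcontfun f x ^ n"
  by (induction n) simp_all


section \<open>Gateaux differentiability\<close>

definition gateaux_differentiable ::
  "('a::real_normed_vector \<Rightarrow> 'b::real_normed_vector) \<Rightarrow> 'a \<Rightarrow> bool" where
  "gateaux_differentiable T f \<longleftrightarrow>
     (\<forall>g. g \<noteq> 0 \<longrightarrow> (\<exists>l. ((\<lambda>t::real. (T (f + t *\<^sub>R g) - T f) /\<^sub>R t) \<longlongrightarrow> l) (at 0)))"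

definition gateaux_derivative ::
  "('a::real_normed_vector \<Rightarrow> 'b::real_normed_vector) \<Rightarrow> 'a \<Rightarrow> 'a \<Rightarrow> 'b" where
  "gateaux_derivative T f g = Lim (at 0) (\<lambda>t::real. (T (f + t *\<^sub>R g) - T f) /\<^sub>R t)"


section \<open>Polynomial type operators\<close>

definition poly_operator :: "nat \<Rightarrow> (nat \<Rightarrow> real) \<Rightarrow> C01 \<Rightarrow> C01" where
  "poly_operator m a f = (\<Sum>i=1..m. a i *\<^sub>R f ^ i)"

end

theory Submission
  imports Defs
begin

text \<open>With pointwise product and maximum norm, C[0,1] is a commutative normed algebra with
  unit. The product rule therefore gives the power rule by induction
  (\<open>has_derivative_power_at\<close>), and linearity gives the Frechet derivative of the
  polynomial (\<open>has_derivative_poly_operator\<close>). Restricting a Frechet differentiable map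
  to the line \<open>f + t *\<^sub>R g\<close> turns its derivative into the limit of difference
  quotients (\<open>has_derivative_imp_directional_limit\<close>), so the Gateaux derivative exists
  and agrees with it.\<close>

lemma has_derivative_power_at:
  fixes x :: "'a::{real_normed_algebra_1, comm_ring_1}"
  shows "((\<lambda>y. y ^ n) has_derivative (\<lambda>h. real n *\<^sub>R (x ^ (n - 1) * h))) (at x)"
proof (induction n)
  case 0
  show ?case by simp
next
  case (Suc n)
  have "((\<lambda>y. y * y ^ n) has_derivative
      (\<lambda>h. x * (real n *\<^sub>R (x ^ (n - 1) * h)) + h * x ^ n)) (at x)"
    by (rule has_derivative_mult[OF has_derivative_ident Suc.IH])
  moreover have "x * (real n *\<^sub>R (x ^ (n - 1) * h)) + h * x ^ n
      = real (Suc n) *\<^sub>R (x ^ (Suc n - 1) * h)" for h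
  proof -
    \<comment> \<open>For \<open>n = 0\<close> the truncated exponent \<open>n - 1\<close> is 0 and
      \<open>x * x ^ (n - 1)\<close> is not \<open>x ^ n\<close>, but the coefficient
      \<open>real n\<close> vanishes.\<close>
    have "x * (real n *\<^sub>R (x ^ (n - 1) * h)) = real n *\<^sub>R (x ^ n * h)"
      by (cases n) (simp_all only: diff_Suc_1 power_Suc mult_scaleR_right mult.assoc of_nat_0
          scaleR_zero_left mult_zero_right)
    moreover have "real (Suc n) *\<^sub>R (x ^ n * h) = real n *\<^sub>R (x ^ n * h) + x ^ n * h"
      by (simp only: of_nat_Suc scaleR_left_distrib scaleR_one add.commute)
    ultimately show ?thesis
      by (simp only: diff_Suc_1 mult.commute[of h])
  qed
  ultimately show ?case by simp
qed

text \<open>Chain rule along the line through \<open>f\<close> in direction \<open>g\<close>, which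
  may be 0; linearity of \<open>D\<close> pulls the scalar \<open>t\<close> out.\<close>

lemma has_derivative_imp_directional_limit:
  assumes "(T has_derivative D) (at f)"
  shows "((\<lambda>t::real. (T (f + t *\<^sub>R g) - T f) /\<^sub>R t) \<longlongrightarrow> D g) (at 0)"
proof -
  interpret D: bounded_linear D
    using assms by (rule has_derivative_bounded_linear)
  have line: "((\<lambda>t::real. f + t *\<^sub>R g) has_derivative (\<lambda>t. t *\<^sub>R g)) (at 0)"
    by (auto intro!: derivative_eq_intros)
  have "((\<lambda>t. T (f + t *\<^sub>R g)) has_derivative (\<lambda>t. D (t *\<^sub>R g))) (at 0)"
    using has_derivative_compose[OF line, of T D] assms by simp
  then have "((\<lambda>t. norm (T (f + t *\<^sub>R g) - T f - t *\<^sub>R D g) / norm t) \<longlongrightarrow> 0) (at 0)"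
    by (simp add: has_derivative_at D.scaleR)
  \<comment> \<open>The two sides can differ at \<open>t = 0\<close>, where division by zero yields
    0; the punctured filter ignores that point.\<close>
  moreover have "\<forall>\<^sub>F t in at (0::real). norm (T (f + t *\<^sub>R g) - T f - t *\<^sub>R D g) / norm t
      = norm ((T (f + t *\<^sub>R g) - T f) /\<^sub>R t - D g)"
    unfolding eventually_at_filter
  proof (rule always_eventually, intro allI impI)
    fix t :: real
    assume "t \<noteq> 0"
    then have "(T (f + t *\<^sub>R g) - T f) /\<^sub>R t - D g
        = (T (f + t *\<^sub>R g) - T f - t *\<^sub>R D g) /\<^sub>R t"
      by (simp add: scaleR_right_diff_distrib)
    then show "norm (T (f + t *\<^sub>R g) - T f - t *\<^sub>R D g) / norm t
        = norm ((T (f + t *\<^sub>R g) - T f) /\<^sub>R t - D g)"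
      by (simp add: divide_inverse mult.commute)
  qed
  ultimately show ?thesis
    by (subst Lim_null, subst tendsto_norm_zero_iff[symmetric]) (rule Lim_transform_eventually)
qed

lemma has_derivative_imp_gateaux_differentiable:
  "(T has_derivative D) (at f) \<Longrightarrow> gateaux_differentiable T f"
  unfolding gateaux_differentiable_def using has_derivative_imp_directional_limit by blast

text \<open>\<open>Lim\<close> picks out the limit because limits along the nontrivial filter
  \<open>at 0\<close> on the reals are unique.\<close>

lemma gateaux_derivative_eq:
  "(T has_derivative D) (at f) \<Longrightarrow> gateaux_derivative T f g = D g"
  unfolding gateaux_derivative_def
  by (intro tendsto_Lim has_derivative_imp_directional_limit) simp_all

lemma has_derivative_poly_operator:
  "(poly_operator m a has_derivative
     (\<lambda>g. \<Sum>i=1..m. (real i * a i) *\<^sub>R (f ^ (i - 1) * g))) (at f)"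
proof -
  have "((\<lambda>f. \<Sum>i=1..m. a i *\<^sub>R f ^ i) has_derivative
     (\<lambda>g. \<Sum>i=1..m. a i *\<^sub>R (real i *\<^sub>R (f ^ (i - 1) * g)))) (at f)"
    by (intro has_derivative_sum has_derivative_scaleR_right has_derivative_power_at)
  then show ?thesis
    by (simp add: poly_operator_def[abs_def] mult.commute)
qed

theorem corollary4p2:
  fixes m :: nat and a :: "nat \<Rightarrow> real"
  assumes "m > 0"
  shows
    "(\<forall>f :: C01. poly_operator m a differentiable (at f) \<and>
        (\<forall>g :: C01. frechet_derivative (poly_operator m a) (at f) g
                      = (\<Sum>i=1..m. (real i * a i) *\<^sub>R (f ^ (i - 1) * g)))) \<and>
     (\<forall>f :: C01. gateaux_differentiable (poly_operator m a) f \<and>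
        (\<forall>g :: C01. gateaux_derivative (poly_operator m a) f g
                      = frechet_derivative (poly_operator m a) (at f) g \<and>
                    frechet_derivative (poly_operator m a) (at f) g
                      = (\<Sum>i=1..m. (real i * a i) *\<^sub>R (f ^ (i - 1) * g))))"
proof -
  \<comment> \<open>\<open>frechet_derivative\<close> is a choice among derivatives; uniqueness at a
    point of the whole space forces it to be the computed operator.\<close>
  have "frechet_derivative (poly_operator m a) (at f)
      = (\<lambda>g. \<Sum>i=1..m. (real i * a i) *\<^sub>R (f ^ (i - 1) * g))" for f
    using frechet_derivative_at[OF has_derivative_poly_operator] by (rule sym)
  then show ?thesis
    using has_derivative_poly_operator[of m a]
    by (auto simp: gateaux_derivative_eq[OF has_derivative_poly_operator]
        intro: differentiableI has_derivative_imp_gateaux_differentiable)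
qed

end
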